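(* Let $n\geq 4$ and let $A$ be an $n\times n$ real matrix. For every integer $k$ with $2\leq k\leq n-2$: if $A$ is $TP_{k+2}$, then the $k$th compound matrix $C_k(A)$ is not $TP_3$.
   Context: For a real $m\times n$ matrix $A$ and index sets $\alpha\subseteq\{1,\ldots,m\}$, $\beta\subseteq\{1,\ldots,n\}$, $A[\alpha,\beta]$ denotes the submatrix of $A$ in the rows indexed by $\alpha$ and columns indexed by $\beta$ (indices in increasing order). A minor of order $r$ of $A$ is $\det A[\alpha,\beta]$ with $|\alpha|=|\beta|=r$. For $1\leq k\leq\min\{m,n\}$, $A$ is called $TP_k$ if all of its minors of every order $1,2,\ldots,k$ are positive. For $k\leq\min\{m,n\}$, the $k$th compound $C_k(A)$ is the $\binom{m}{k}\times\binom{n}{k}$ matrix whose entries are all the minors $\det A[\alpha,\beta]$ with $|\alpha|=|\beta|=k$, where the row index sets $\alpha$ and the column index sets $\beta$ are each ordered lexicographically. *)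

theory Defs
  imports "Jordan_Normal_Form.Determinant" "Jordan_Normal_Form.DL_Submatrix"
    "HOL-Library.List_Lexorder"
begin

text \<open>Row and column indices are 0-based, as in \<^typ>\<open>'a mat\<close>.\<close>

text \<open>A set is identified with the increasing list of its elements; the order on \<^typ>\<open>nat list\<close>
  is the lexicographic one from \<^theory>\<open>HOL-Library.List_Lexorder\<close>.\<close>

definition lex_subsets :: "nat \<Rightarrow> nat \<Rightarrow> nat set list" where
  "lex_subsets n k =
     map set (sorted_list_of_set (sorted_list_of_set ` {I. I \<subseteq> {..<n} \<and> card I = k}))"

lemma map_lex_subsets:
  "map sorted_list_of_set (lex_subsets n k) =
     sorted_list_of_set (sorted_list_of_set ` {I. I \<subseteq> {..<n} \<and> card I = k})"
  unfolding lex_subsets_def map_map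
proof (rule map_idI)
  fix xs
  assume "xs \<in> set (sorted_list_of_set (sorted_list_of_set ` {I. I \<subseteq> {..<n} \<and> card I = k}))"
  then obtain I where "I \<subseteq> {..<n}" "xs = sorted_list_of_set I"
    by auto
  then show "(sorted_list_of_set \<circ> set) xs = xs"
    by (simp add: finite_subset)
qed

lemma sorted_lex_subsets: "sorted_wrt (<) (map sorted_list_of_set (lex_subsets n k))"
  unfolding map_lex_subsets by simp

lemma distinct_lex_subsets: "distinct (lex_subsets n k)"
  using distinct_sorted_list_of_set[of "sorted_list_of_set ` {I. I \<subseteq> {..<n} \<and> card I = k}"]
  unfolding map_lex_subsets[symmetric] distinct_map by simp

lemma set_lex_subsets: "set (lex_subsets n k) = {I. I \<subseteq> {..<n} \<and> card I = k}"
proof -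
  have "set (sorted_list_of_set I) = I" if "I \<subseteq> {..<n}" for I
    using that by (simp add: finite_subset)
  then show ?thesis
    unfolding lex_subsets_def by (force simp: image_image)
qed

lemma length_lex_subsets: "length (lex_subsets n k) = n choose k"
  using distinct_card[OF distinct_lex_subsets, of n k] by (simp add: set_lex_subsets n_subsets)

text \<open>The requirement that \<open>k\<close> be at most both dimensions is not part of the definition: for larger
  \<open>k\<close> the additional orders admit no minors.\<close>

definition TP :: "nat \<Rightarrow> real mat \<Rightarrow> bool" where
  "TP k A \<longleftrightarrow> (\<forall>r\<in>{1..k}. \<forall>I J. I \<subseteq> {..<dim_row A} \<and> card I = r \<and> J \<subseteq> {..<dim_col A} \<and> card J = r
     \<longrightarrow> det (submatrix A I J) > 0)"

definition compound :: "nat \<Rightarrow> real mat \<Rightarrow> real mat" where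
  "compound k A = mat (dim_row A choose k) (dim_col A choose k)
     (\<lambda>(i, j). det (submatrix A (lex_subsets (dim_row A) k ! i) (lex_subsets (dim_col A) k ! j)))"

end

theory Submission
  imports Defs
begin

text \<open>The compound of any matrix has a vanishing minor of order 3. Take the row sets
  \<open>{0, \<dots>, k - 2} \<union> {i}\<close> for \<open>i = k - 1, k, k + 1\<close> and three \<open>k\<close>-subsets of \<open>{0, \<dots>, k}\<close> as column
  sets. Truncating the first \<open>k + 2\<close> rows of \<open>A\<close> to \<open>k + 1\<close> columns gives \<open>k + 2\<close> vectors in a space
  of dimension \<open>k + 1\<close>, hence a linear relation. Wedging it with the first \<open>k - 1\<close> vectors kills all
  of its terms but the last three, which leaves a linear relation between three rows of the compound.
  It is nontrivial because positivity of the minors makes the first \<open>k - 1\<close> vectors independent.\<close>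

text \<open>A row relation is a kernel vector of the transpose. The coefficients form a function on
  indices, not a vector, so that sums can be reindexed along bijections.\<close>

lemma det_eq_0_iff_rows_dependent:
  fixes A :: "'a :: idom mat"
  assumes A: "A \<in> carrier_mat n n"
  shows "det A = 0 \<longleftrightarrow> (\<exists>w. (\<exists>i<n. w i \<noteq> 0) \<and> (\<forall>j<n. (\<Sum>i<n. w i * A $$ (i, j)) = 0))"
proof -
  have AT: "transpose_mat A \<in> carrier_mat n n"
    using A by simp
  have kernel: "transpose_mat A *\<^sub>v v = 0\<^sub>v n \<longleftrightarrow> (\<forall>j<n. (\<Sum>i<n. v $ i * A $$ (i, j)) = 0)"
    if "v \<in> carrier_vec n" for v
    using A that by (auto simp: vec_eq_iff scalar_prod_def lessThan_atLeast0 mult.commute)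
  have nonzero: "v \<noteq> 0\<^sub>v n \<longleftrightarrow> (\<exists>i<n. v $ i \<noteq> 0)" if "v \<in> carrier_vec n" for v :: "'a vec"
    using that by (auto simp: vec_eq_iff)
  have "det A = 0 \<longleftrightarrow> (\<exists>v. v \<in> carrier_vec n \<and> v \<noteq> 0\<^sub>v n \<and> transpose_mat A *\<^sub>v v = 0\<^sub>v n)"
    using det_0_iff_vec_prod_zero[OF AT] det_transpose[OF A] by simp
  also have "\<dots> \<longleftrightarrow> (\<exists>w. (\<exists>i<n. w i \<noteq> 0) \<and> (\<forall>j<n. (\<Sum>i<n. w i * A $$ (i, j)) = 0))"
    (is "?L \<longleftrightarrow> ?R")
  proof
    assume ?L
    then obtain v where "v \<in> carrier_vec n" "v \<noteq> 0\<^sub>v n" "transpose_mat A *\<^sub>v v = 0\<^sub>v n"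
      by blast
    then show ?R
      using kernel nonzero by (intro exI[of _ "\<lambda>i. v $ i"]) blast
  next
    assume ?R
    then obtain w where w: "\<exists>i<n. w i \<noteq> 0" "\<forall>j<n. (\<Sum>i<n. w i * A $$ (i, j)) = 0"
      by blast
    have "vec n w \<in> carrier_vec n" by simp
    moreover have "vec n w \<noteq> 0\<^sub>v n"
      using w(1) nonzero[of "vec n w"] by (metis index_vec vec_carrier)
    moreover have "transpose_mat A *\<^sub>v vec n w = 0\<^sub>v n"
      using w(2) kernel[of "vec n w"] by simp
    ultimately show ?L by blast
  qed
  finally show ?thesis .
qed

lemma bij_betw_pick:
  assumes "finite I"
  shows "bij_betw (pick I) {..<card I} I"
proof (rule bij_betw_imageI)
  show inj: "inj_on (pick I) {..<card I}"
    by (rule linorder_inj_onI') (use pick_mono_le in fastforce)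
  have "pick I ` {..<card I} \<subseteq> I"
    using pick_in_set_le by auto
  then show "pick I ` {..<card I} = I"
    using assms inj by (simp add: card_image card_subset_eq)
qed

lemma submatrix_eq_mat:
  assumes "I \<subseteq> {..<dim_row A}" and "J \<subseteq> {..<dim_col A}"
  shows "submatrix A I J = mat (card I) (card J) (\<lambda>(r, c). A $$ (pick I r, pick J c))"
proof -
  have "{i. i < dim_row A \<and> i \<in> I} = I" "{j. j < dim_col A \<and> j \<in> J} = J"
    using assms by auto
  then show ?thesis
    by (simp add: submatrix_def)
qed

text \<open>\<open>pick I\<close> and \<open>pick J\<close> turn positions in the submatrix into
  indices of \<open>A\<close>, which carries the relation over to the rows of the submatrix. It
  serves twice: for a minor of \<open>A\<close> and for a minor of its compound.\<close>

lemma det_submatrix_rows_dependent: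
  fixes A :: "'a :: idom mat"
  assumes I: "I \<subseteq> {..<dim_row A}" and J: "J \<subseteq> {..<dim_col A}" and card: "card I = card J"
    and w: "i \<in> I" "w i \<noteq> 0"
    and dep: "\<And>j. j \<in> J \<Longrightarrow> (\<Sum>i\<in>I. w i * A $$ (i, j)) = 0"
  shows "det (submatrix A I J) = 0"
proof -
  have fin: "finite I" "finite J"
    using I J finite_subset by blast+
  have bij: "bij_betw (pick I) {..<card I} I"
    using fin(1) by (rule bij_betw_pick)
  obtain r where r: "r < card I" "pick I r = i"
    using w(1) bij by (metis bij_betw_iff_bijections lessThan_iff)
  have "(\<Sum>r<card I. w (pick I r) * submatrix A I J $$ (r, c)) = 0" if c: "c < card I" for c
  proof -
    have "(\<Sum>r<card I. w (pick I r) * submatrix A I J $$ (r, c))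
        = (\<Sum>r<card I. w (pick I r) * A $$ (pick I r, pick J c))"
      using c card by (simp add: submatrix_eq_mat[OF I J])
    also have "\<dots> = (\<Sum>i\<in>I. w i * A $$ (i, pick J c))"
      using sum.reindex_bij_betw[OF bij] by fastforce
    also have "\<dots> = 0"
      using c card by (intro dep pick_in_set_le) simp
    finally show ?thesis .
  qed
  moreover have "submatrix A I J \<in> carrier_mat (card I) (card I)"
    using card by (simp add: submatrix_eq_mat[OF I J])
  ultimately show ?thesis
    using r w(2) by (subst det_eq_0_iff_rows_dependent) (auto intro!: exI[of _ "\<lambda>r. w (pick I r)"])
qed

text \<open>A zero column pads the block of \<open>m + 1\<close> rows and \<open>m\<close> columns
  to a square matrix that kills the last unit vector and is therefore singular.\<close>

lemma rows_dependent:
  fixes A :: "'a :: idom mat"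
  obtains u where "\<exists>i<Suc m. u i \<noteq> 0" "\<And>j. j < m \<Longrightarrow> (\<Sum>i<Suc m. u i * A $$ (i, j)) = 0"
proof -
  define B where "B = mat (Suc m) (Suc m) (\<lambda>(i, j). if j < m then A $$ (i, j) else 0)"
  have B: "B \<in> carrier_mat (Suc m) (Suc m)"
    by (simp add: B_def)
  have "B *\<^sub>v unit_vec (Suc m) m = 0\<^sub>v (Suc m)"
    by (rule eq_vecI) (auto simp: B_def)
  then have "det B = 0"
    unfolding det_0_iff_vec_prod_zero[OF B] by (intro exI[of _ "unit_vec (Suc m) m"]) simp
  then obtain u where u: "\<exists>i<Suc m. u i \<noteq> 0" "\<forall>j<Suc m. (\<Sum>i<Suc m. u i * B $$ (i, j)) = 0"
    unfolding det_eq_0_iff_rows_dependent[OF B] by blast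
  have "(\<Sum>i<Suc m. u i * A $$ (i, j)) = 0" if "j < m" for j
    using u(2)[rule_format, of j] that by (simp add: B_def)
  with u(1) that show thesis by blast
qed

text \<open>As \<open>m \<le> i\<close>, the row \<open>i\<close> comes last in increasing order.
  The varying row thus keeps the same position for all \<open>i\<close>, and no signs arise.\<close>

lemma submatrix_insert_row:
  assumes "m \<le> i" "i < dim_row A" and J: "J \<subseteq> {..<dim_col A}" "card J = Suc m"
  shows "submatrix A (insert i {..<m}) J =
    mat (Suc m) (Suc m) (\<lambda>(r, c). A $$ (if r < m then r else i, pick J c))"
proof -
  let ?I = "insert i {..<m}"
  have I: "?I \<subseteq> {..<dim_row A}" "card ?I = Suc m"
    using assms by auto
  have "pick ?I r = r" if "r < m" for r
  proof -
    have "{a \<in> ?I. a < r} = {..<r}"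
      using that assms(1) by auto
    then show ?thesis
      using pick_card_in_set[of r ?I] that by simp
  qed
  moreover have "pick ?I m = i"
  proof -
    have "{a \<in> ?I. a < i} = {..<m}"
      using assms(1) by auto
    then show ?thesis
      using pick_card_in_set[of i ?I] by simp
  qed
  ultimately show ?thesis
    unfolding submatrix_eq_mat[OF I(1) J(1)] I(2) J(2)
    by (intro cong_mat) (auto simp: less_Suc_eq)
qed

text \<open>The determinant with last row \<open>i\<close> is linear in that row, so the relation \<open>u\<close> carries over, and it
  vanishes for \<open>i < m\<close> because row \<open>i\<close> then occurs twice.\<close>

lemma minors_dependent:
  fixes A :: "'a :: idom mat"
  assumes N: "m \<le> N" "N \<le> dim_row A" and J: "J \<subseteq> {..<dim_col A}" "card J = Suc m"
    and u: "\<And>j. j \<in> J \<Longrightarrow> (\<Sum>i<N. u i * A $$ (i, j)) = 0"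
  shows "(\<Sum>i=m..<N. u i * det (submatrix A (insert i {..<m}) J)) = 0"
proof -
  define M where "M i = mat (Suc m) (Suc m) (\<lambda>(r, c). A $$ (if r < m then r else i, pick J c))" for i
  have M: "M i \<in> carrier_mat (Suc m) (Suc m)" for i
    by (simp add: M_def)
  \<comment> \<open>Deleting row \<open>m\<close> removes the only row that depends on
    \<open>i\<close>; \<open>M 0\<close> is just a fixed representative.\<close>
  have cof: "cofactor (M i) m c = cofactor (M 0) m c" for i c
    unfolding cofactor_def
    by (intro arg_cong2[where f = "(*)"] arg_cong[where f = det] eq_matI refl)
      (auto simp: M_def mat_delete_def)
  have det_M: "det (M i) = (\<Sum>c<Suc m. A $$ (i, pick J c) * cofactor (M 0) m c)" for i
    unfolding laplace_expansion_row[OF M lessI] by (intro sum.cong refl) (simp add: cof[of i], simp add: M_def)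
  have zero: "det (M i) = 0" if "i < m" for i
    by (rule det_identical_rows[OF M, of i m]) (use that in \<open>auto simp: M_def\<close>)
  have "(\<Sum>i<N. u i * det (M i))
      = (\<Sum>i<N. \<Sum>c<Suc m. u i * A $$ (i, pick J c) * cofactor (M 0) m c)"
    unfolding det_M sum_distrib_left by (simp only: mult.assoc)
  also have "\<dots> = (\<Sum>c<Suc m. (\<Sum>i<N. u i * A $$ (i, pick J c)) * cofactor (M 0) m c)"
    by (subst sum.swap) (simp only: sum_distrib_right)
  also have "\<dots> = 0"
    using u pick_in_set_le[of _ J] J(2) by (intro sum.neutral) auto
  also have "(\<Sum>i<N. u i * det (M i)) = (\<Sum>i=m..<N. u i * det (M i))"
    using N zero by (intro sum.mono_neutral_right) auto
  also have "\<dots> = (\<Sum>i=m..<N. u i * det (submatrix A (insert i {..<m}) J))"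
    using N J by (intro sum.cong refl) (simp add: submatrix_insert_row M_def)
  finally show ?thesis .
qed

lemma TP_minor_pos:
  assumes "TP k A" "I \<subseteq> {..<dim_row A}" "J \<subseteq> {..<dim_col A}"
    and "card I = card J" "1 \<le> card I" "card I \<le> k"
  shows "det (submatrix A I J) > 0"
  using assms unfolding TP_def by (metis atLeastAtMost_iff)

text \<open>Minors of the compound are addressed by positions in the lexicographic list, whereas the
  argument works with families of subsets.\<close>

lemma lex_subsets_positions:
  assumes "\<R> \<subseteq> {I. I \<subseteq> {..<n} \<and> card I = k}"
  obtains P where "P \<subseteq> {..<n choose k}" "bij_betw ((!) (lex_subsets n k)) P \<R>"
proof -
  have bij: "bij_betw ((!) (lex_subsets n k)) {..<n choose k} {I. I \<subseteq> {..<n} \<and> card I = k}"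
    using distinct_lex_subsets by (intro bij_betw_nth) (simp_all add: length_lex_subsets set_lex_subsets)
  then obtain P where "P \<subseteq> {..<n choose k}" "\<R> = (!) (lex_subsets n k) ` P"
    using assms unfolding bij_betw_def by (metis subset_imageE)
  with that bij_betw_subset[OF bij] show thesis by blast
qed

text \<open>The minor at the positions of the two families vanishes. Vanishing does not depend on
  the order of rows and columns, so these positions are never computed.\<close>

lemma not_TP_compound:
  assumes rows: "\<R> \<subseteq> {I. I \<subseteq> {..<dim_row A} \<and> card I = k}" "card \<R> = r"
    and cols: "\<S> \<subseteq> {J. J \<subseteq> {..<dim_col A} \<and> card J = k}" "card \<S> = r"
    and w: "I \<in> \<R>" "w I \<noteq> 0"
    and dep: "\<And>J. J \<in> \<S> \<Longrightarrow> (\<Sum>I\<in>\<R>. w I * det (submatrix A I J)) = 0"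
  shows "\<not> TP r (compound k A)"
proof
  assume TP: "TP r (compound k A)"
  let ?f = "(!) (lex_subsets (dim_row A) k)" and ?g = "(!) (lex_subsets (dim_col A) k)"
  obtain P where P: "P \<subseteq> {..<dim_row A choose k}" and f: "bij_betw ?f P \<R>"
    using rows(1) by (rule lex_subsets_positions)
  obtain Q where Q: "Q \<subseteq> {..<dim_col A choose k}" and g: "bij_betw ?g Q \<S>"
    using cols(1) by (rule lex_subsets_positions)
  have PQ: "P \<subseteq> {..<dim_row (compound k A)}" "Q \<subseteq> {..<dim_col (compound k A)}"
    using P Q by (simp_all add: compound_def)
  have card: "card P = r" "card Q = r"
    using f g rows(2) cols(2) by (simp_all add: bij_betw_same_card)
  obtain p where p: "p \<in> P" "?f p = I"
    using w(1) f by (metis bij_betw_iff_bijections)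
  have "finite P"
    using P finite_subset by blast
  \<comment> \<open>The orders in \<open>TP\<close> start at 1; the member \<open>I\<close> of the
    row family ensures this.\<close>
  then have "1 \<le> card P"
    using p(1) by (auto simp: Suc_le_eq card_gt_0_iff)
  then have pos: "det (submatrix (compound k A) P Q) > 0"
    using PQ card by (intro TP_minor_pos[OF TP]) simp_all
  have "det (submatrix (compound k A) P Q) = 0"
  proof (rule det_submatrix_rows_dependent[where w = "\<lambda>p. w (?f p)"])
    fix q assume q: "q \<in> Q"
    have "(\<Sum>p\<in>P. w (?f p) * compound k A $$ (p, q))
        = (\<Sum>p\<in>P. w (?f p) * det (submatrix A (?f p) (?g q)))"
      using q P Q by (intro sum.cong refl) (auto simp: compound_def subset_iff)
    also have "\<dots> = (\<Sum>I\<in>\<R>. w I * det (submatrix A I (?g q)))"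
      by (rule sum.reindex_bij_betw[OF f])
    also have "\<dots> = 0"
      using dep g q by (auto simp: bij_betw_def)
    finally show "(\<Sum>p\<in>P. w (?f p) * compound k A $$ (p, q)) = 0" .
  qed (use PQ card p w(2) in auto)
  with pos show False by simp
qed

lemma not_TP_3_compound:
  assumes k: "2 \<le> k" and dims: "k + 2 \<le> dim_row A" "k + 1 \<le> dim_col A" and TP: "TP k A"
  shows "\<not> TP 3 (compound k A)"
proof -
  \<comment> \<open>The number of rows common to the three row sets.\<close>
  define m where "m = k - 1"
  have km: "k = Suc m"
    using k by (simp add: m_def)
  obtain u where u: "\<exists>i<Suc (k + 1). u i \<noteq> 0"
    "\<And>j. j < k + 1 \<Longrightarrow> (\<Sum>i<Suc (k + 1). u i * A $$ (i, j)) = 0"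
    using rows_dependent[of "k + 1" A] by blast
  define R where "R i = insert i {..<m}" for i
  have R: "R i \<subseteq> {..<dim_row A}" "card (R i) = k" if "i \<in> {m..<k + 2}" for i
    using that dims by (auto simp: R_def km)
  have inj_R: "inj_on R {m..<k + 2}"
    unfolding R_def by (rule inj_onI) auto
  have Max_R: "Max (R i) = i" if "i \<in> {m..<k + 2}" for i
    using that unfolding R_def by (intro Max_eqI) auto
  \<comment> \<open>All \<open>S d\<close> lie in the \<open>k + 1\<close> columns on which
    \<open>u\<close> is a relation. Since \<open>2 \<le> k\<close>, omitting column 0, 1 or 2 gives
    three different sets.\<close>
  define S where "S d = {..k} - {d}" for d
  have S: "S d \<subseteq> {..<dim_col A}" "S d \<subseteq> {..<k + 1}" "card (S d) = k" if "d < 3" for d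
    using that dims k by (auto simp: S_def)
  have inj_S: "inj_on S {..<3}"
  proof (rule inj_onI)
    fix d e assume "d \<in> {..<3}" "e \<in> {..<3::nat}" and eq: "S d = S e"
    then have "d \<le> k" "e \<le> k"
      using k by auto
    then show "d = e"
      using eq unfolding S_def by auto
  qed
  have "\<exists>i\<in>{m..<k + 2}. u i \<noteq> 0"
  proof (rule ccontr)
    assume tail: "\<not> ?thesis"
    then obtain i where i: "i < m" "u i \<noteq> 0"
      using u(1) by (metis Suc_eq_plus1 add_2_eq_Suc' atLeastLessThan_iff not_less)
    \<comment> \<open>\<open>R m\<close> consists of the first \<open>k\<close> rows. If the last
      three coefficients vanish, \<open>u\<close> relates the rows below \<open>m\<close>; row
      \<open>m\<close> joins with coefficient 0 to give a minor of order \<open>k\<close>, which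
      \<open>TP k A\<close> makes positive.\<close>
    have "det (submatrix A (R m) (S 0)) = 0"
    proof (rule det_submatrix_rows_dependent[where w = u and i = i])
      fix j assume "j \<in> S 0"
      then have "(\<Sum>i<Suc (k + 1). u i * A $$ (i, j)) = 0"
        using u(2) S(2)[of 0] by auto
      also have "(\<Sum>i<Suc (k + 1). u i * A $$ (i, j)) = (\<Sum>i\<in>R m. u i * A $$ (i, j))"
        using tail by (intro sum.mono_neutral_right) (auto simp: R_def km)
      finally show "(\<Sum>i\<in>R m. u i * A $$ (i, j)) = 0" .
    qed (use i R[of m] S[of 0] in \<open>auto simp: R_def km\<close>)
    moreover have "det (submatrix A (R m) (S 0)) > 0"
      by (rule TP_minor_pos[OF TP]) (use R[of m] S[of 0] in \<open>auto simp: km\<close>)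
    ultimately show False by simp
  qed
  then obtain i where i: "i \<in> {m..<k + 2}" "u i \<noteq> 0"
    by blast
  have families: "R ` {m..<k + 2} \<subseteq> {I. I \<subseteq> {..<dim_row A} \<and> card I = k}"
    "S ` {..<3} \<subseteq> {J. J \<subseteq> {..<dim_col A} \<and> card J = k}"
    using R S by blast+
  show ?thesis
  \<comment> \<open>The coefficients must be attached to row sets: \<open>Max\<close> recovers
    \<open>i\<close> from \<open>R i\<close>. Both families have size 3, as
    \<open>m = k - 1\<close>.\<close>
  proof (rule not_TP_compound[where \<R> = "R ` {m..<k + 2}" and \<S> = "S ` {..<3}"
        and w = "\<lambda>I. u (Max I)" and I = "R i"])
    fix J assume "J \<in> S ` {..<3}"
    then obtain d where d: "d < 3" and J: "J = S d"
      by auto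
    have "(\<Sum>I\<in>R ` {m..<k + 2}. u (Max I) * det (submatrix A I J))
        = (\<Sum>i=m..<k + 2. u i * det (submatrix A (R i) J))"
      unfolding sum.reindex[OF inj_R] by (intro sum.cong refl) (simp add: Max_R)
    also have "\<dots> = 0"
      unfolding R_def
    proof (rule minors_dependent)
      show "(\<Sum>i<k + 2. u i * A $$ (i, j)) = 0" if "j \<in> J" for j
        using u(2)[of j] S(2)[OF d] that J by auto
    qed (use S[OF d] J dims km in auto)
    finally show "(\<Sum>I\<in>R ` {m..<k + 2}. u (Max I) * det (submatrix A I J)) = 0" .
  qed (use i families Max_R inj_R inj_S in \<open>simp_all add: card_image km\<close>)
qed

theorem theorem1:
  fixes n :: nat and A :: "real mat"
  assumes "n \<ge> 4"
    and "A \<in> carrier_mat n n"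
  shows "\<forall>k. 2 \<le> k \<and> k \<le> n - 2 \<longrightarrow> TP (k + 2) A \<longrightarrow> \<not> TP 3 (compound k A)"
proof (intro allI impI)
  fix k assume k: "2 \<le> k \<and> k \<le> n - 2" and "TP (k + 2) A"
  then have "TP k A"
    unfolding TP_def by (metis atLeastAtMost_iff trans_le_add1)
  then show "\<not> TP 3 (compound k A)"
    using k assms by (intro not_TP_3_compound) auto
qed

end
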